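(* Let $E$ be a quadratic word equation over constants $A$ and variables $V$, let $S$ be a finite set of regular constraints on variables of $E$, and let $\mathcal{C}(E,S)$ be the associated counter system (defined in the context). Then for every $\mathbf{v}\in\mathbb{N}^V$: $\mathbf{v}$ is the vector $(|\sigma(x)|)_{x\in V}$ of some solution $\sigma$ of $E$ satisfying all constraints in $S$ if and only if there is $\mathbf{w}\in\mathbb{N}^V$ such that the configuration $((E,S),\mathbf{v})$ reaches the configuration $((\epsilon=\epsilon,\emptyset),\mathbf{w})$ in the transition system of $\mathcal{C}(E,S)$.
   Context: Let $A$ be a finite alphabet of constants and $V$ a finite set of variables, $A\cap V=\emptyset$. A word equation is $L=R$ with $L,R\in(A\cup V)^*$; quadratic means each variable occurs at most twice in total. A solution is a homomorphism $\sigma:(A\cup V)^*\to A^*$ fixing $A$ pointwise with $\sigma(L)=\sigma(R)$. For an NFA $\mathcal{A}$ over $A$ and states $p,q$, $\mathcal{A}_{p,q}$ denotes $\mathcal{A}$ with initial state $p$ and single final state $q$. A regular constraint is $x\in\mathcal{L}(\mathcal{A}_{p,q})$; $\sigma$ satisfies it if $\sigma(x)\in\mathcal{L}(\mathcal{A}_{p,q})$. $w[u/z]$ denotes $w$ with every occurrence of variable $z$ replaced by $u$. Nielsen transformation on equations: for $E=(\alpha w_1=\beta w_2)$, $\alpha,\beta\in A\cup V$: (Erase) if $\alpha\in V$, $E'=E[\epsilon/\alpha]$ (symmetrically for $\beta$); (P1) if $\alpha=\beta$, $E'$ is $w_1=w_2$; (P2) $\alpha\in A,\beta\in V$: $E'$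 is $w_1[\alpha\beta/\beta]=\beta w_2[\alpha\beta/\beta]$; (P3) $\alpha\in V,\beta\in A$: $E'$ is $\alpha w_1[\beta\alpha/\alpha]=w_2[\beta\alpha/\alpha]$; (P4) $\alpha,\beta$ distinct variables: either (case $\alpha\preceq\beta$) $E'$ is $w_1[\alpha\beta/\beta]=\beta w_2[\alpha\beta/\beta]$ or (case $\beta\preceq\alpha$) $E'$ is $\alpha w_1[\beta\alpha/\alpha]=w_2[\beta\alpha/\alpha]$. Extension to pairs $(E,S)$: $(E,S)\Rightarrow(E',S')$ requires $E\Rightarrow E'$ and: for erasing $x$, every constraint $x\in\mathcal{L}$ in $S$ must have $\epsilon\in\mathcal{L}$, and $S'$ is $S$ minus all constraints on $x$; for (P1), $S'$ is $S$ minus all constraints on $\alpha$ if $\alpha$ is a variable; for (P2)–(P4) in the case where $\beta$ is the variable being split as $\alpha\beta$ (the other case is symmetric with roles of $\alpha,\beta$ swapped), for each constraint $\beta\in\mathcal{L}(\mathcal{A}_{p,q})$ in $S$ a state $r$ of $\mathcal{A}$ is guessed and $\beta\in\mathcal{L}(\mathcal{A}_{r,q})$ is put in $S'$ together with $\alpha\in\mathcal{L}(\mathcal{A}_{p,r})$ if $\alpha$ is a variable, while if $\alpha\in A$ one requires $\alpha\in\mathcal{L}(\mathcal{A}_{p,r})$ (otherwise the step is not allowed) and adds nothing; all constraints in $S$ on other variables are kept in $S'$. Counter systems $(X,Q,\Delta)$: counters $X$, control states $Q$, transitions $(q,\Phi(\bar x,\bar x'),q')$ with $\Phi$ Presburger;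 configurations $(q,\mathbf v)\in Q\times\mathbb{N}^X$, $(q,\mathbf v)\to(q',\mathbf v')$ iff some transition has $\Phi(\mathbf v,\mathbf v')$ true. Abbreviations $\mathrm{ID}:=\bigwedge_x x'=x$, $\mathrm{SUB}_{y,z}:=z\le y\wedge y'=y-z\wedge\bigwedge_{x\ne y}x'=x$, $\mathrm{DEC}_y:=y>0\wedge y'=y-1\wedge\bigwedge_{x\ne y}x'=x$. For an equation step $E_1\Rightarrow E_2$ its formula $\Phi$ is: $y=0\wedge\mathrm{ID}$ for erasing $y$; $\mathrm{ID}$ for (P1); $\mathrm{DEC}_\beta$ for (P2); $\mathrm{DEC}_\alpha$ for (P3); $\mathrm{SUB}_{\beta,\alpha}$ for (P4) case $\alpha\preceq\beta$, $\mathrm{SUB}_{\alpha,\beta}$ for case $\beta\preceq\alpha$. $\mathcal{C}(E,S)$: counters $X=V$; control states all pairs $(E',S')$ with $(E,S)\Rightarrow^*(E',S')$; for each step $(E_1,S_1)\Rightarrow(E_2,S_2)$ a transition from $(E_1,S_1)$ to $(E_2,S_2)$ with formula $\Phi\wedge\bigwedge_{x\in V}\big(x\in\mathrm{Len}(L_{S_1,x})\wedge x'\in\mathrm{Len}(L_{S_2,x})\big)$, where $\Phi$ is the formula of the underlying equation step, $L_{S,x}$ is the intersection of all languages $\mathcal{L}$ with $(x\in\mathcal{L})\in S$ (equal to $A^*$ if there are none), and $\mathrm{Len}(L)=\{|w|:w\in L\}$ (a semilinear subset of $\mathbb{N}$).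
   Formalization: The claim fails as written (x = y with y ∈ {a}), so a step is added to C(E,S): if x no longer occurs in the equation, its constraints may be removed, with formula ID and the usual length guards. Erasing is also allowed when the other side is ε, and A is taken to be non-empty. *)

theory Defs
  imports "HOL-Library.FuncSet"
begin

section \<open>Word equations\<close>

text \<open>The alphabet of constants is the whole (finite, non-empty) type \<open>'a\<close>; the variables are
  given by an explicit finite set \<open>V :: 'v set\<close>.\<close>

datatype ('a, 'v) sym = Con 'a | Var 'v

type_synonym ('a, 'v) word = "('a, 'v) sym list"
type_synonym ('a, 'v) eqn = "('a, 'v) word \<times> ('a, 'v) word"

definition vars :: "('a, 'v) eqn \<Rightarrow> 'v set" where
  "vars E = {x. Var x \<in> set (fst E) \<union> set (snd E)}"

definition quadratic :: "('a, 'v) eqn \<Rightarrow> bool" where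
  "quadratic E \<longleftrightarrow> (\<forall>x. count_list (fst E @ snd E) (Var x) \<le> 2)"

definition const_hom :: "(('a, 'v) word \<Rightarrow> 'a list) \<Rightarrow> bool" where
  "const_hom \<sigma> \<longleftrightarrow>
     \<sigma> [] = [] \<and> (\<forall>u w. \<sigma> (u @ w) = \<sigma> u @ \<sigma> w) \<and> (\<forall>a. \<sigma> [Con a] = [a])"

definition solution :: "(('a, 'v) word \<Rightarrow> 'a list) \<Rightarrow> ('a, 'v) eqn \<Rightarrow> bool" where
  "solution \<sigma> E \<longleftrightarrow> const_hom \<sigma> \<and> \<sigma> (fst E) = \<sigma> (snd E)"

definition subst :: "'v \<Rightarrow> ('a, 'v) word \<Rightarrow> ('a, 'v) word \<Rightarrow> ('a, 'v) word" where
  "subst z u w = concat (map (\<lambda>s. if s = Var z then u else [s]) w)"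


section \<open>Regular constraints\<close>

record ('a, 's) nfa =
  nfa_states :: "'s set"
  nfa_trans :: "('s \<times> 'a \<times> 's) set"
  nfa_init :: "'s set"
  nfa_final :: "'s set"

definition wf_nfa :: "('a, 's) nfa \<Rightarrow> bool" where
  "wf_nfa M \<longleftrightarrow> finite (nfa_states M) \<and>
     nfa_trans M \<subseteq> nfa_states M \<times> UNIV \<times> nfa_states M \<and>
     nfa_init M \<subseteq> nfa_states M \<and> nfa_final M \<subseteq> nfa_states M"

fun nfa_run :: "('a, 's) nfa \<Rightarrow> 's \<Rightarrow> 'a list \<Rightarrow> 's \<Rightarrow> bool" where
  "nfa_run M p [] q \<longleftrightarrow> p = q"
| "nfa_run M p (a # w) q \<longleftrightarrow> (\<exists>r. (p, a, r) \<in> nfa_trans M \<and> nfa_run M r w q)"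

definition nfa_lang :: "('a, 's) nfa \<Rightarrow> 'a list set" where
  "nfa_lang M = {w. \<exists>p \<in> nfa_init M. \<exists>q \<in> nfa_final M. nfa_run M p w q}"

definition nfa_between :: "('a, 's) nfa \<Rightarrow> 's \<Rightarrow> 's \<Rightarrow> ('a, 's) nfa" where
  "nfa_between M p q = M\<lparr>nfa_init := {p}, nfa_final := {q}\<rparr>"

text \<open>\<open>In x M p q\<close> is the constraint that \<open>x\<close> lies in the language of \<open>nfa_between M p q\<close>.\<close>

datatype ('a, 'v, 's) rcon =
  In (con_var: 'v) (con_nfa: "('a, 's) nfa") (con_src: 's) (con_dst: 's)

definition con_lang :: "('a, 'v, 's) rcon \<Rightarrow> 'a list set" where
  "con_lang c = nfa_lang (nfa_between (con_nfa c) (con_src c) (con_dst c))"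

definition wf_con :: "('a, 'v, 's) rcon \<Rightarrow> bool" where
  "wf_con c \<longleftrightarrow> wf_nfa (con_nfa c) \<and>
     con_src c \<in> nfa_states (con_nfa c) \<and> con_dst c \<in> nfa_states (con_nfa c)"

definition satisfies :: "(('a, 'v) word \<Rightarrow> 'a list) \<Rightarrow> ('a, 'v, 's) rcon set \<Rightarrow> bool" where
  "satisfies \<sigma> S \<longleftrightarrow> (\<forall>c\<in>S. \<sigma> [Var (con_var c)] \<in> con_lang c)"

definition lang_of :: "('a, 'v, 's) rcon set \<Rightarrow> 'v \<Rightarrow> 'a list set" where
  "lang_of S x = \<Inter> {con_lang c | c. c \<in> S \<and> con_var c = x}"

definition Len :: "'a list set \<Rightarrow> nat set" where
  "Len L = {length w | w. w \<in> L}"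

definition remove_cons :: "'v \<Rightarrow> ('a, 'v, 's) rcon set \<Rightarrow> ('a, 'v, 's) rcon set" where
  "remove_cons x S = {c \<in> S. con_var c \<noteq> x}"


section \<open>Nielsen transformation\<close>

text \<open>Each step carries a label recording the rule that was used, because the counter formula and
  the effect on the constraints depend on the rule and not only on the two equations.
  \<open>Peel y s\<close> is the step splitting the variable \<open>y\<close> as \<open>s y\<close>.\<close>

datatype ('a, 'v) rule =
    Erase 'v
  | Cancel "('a, 'v) sym"
  | Peel 'v "('a, 'v) sym"
  | Discard 'v

text \<open>A leading variable may be erased also when the other side is empty: otherwise \<open>x = \<epsilon>\<close>
  would have no successor at all.

  The rule \<open>discard\<close> has no counterpart in the usual list of Nielsen rules. When both \<open>x\<close> and \<open>y\<close>
  occur exactly once, peeling \<open>x\<close> off \<open>y\<close> removes \<open>x\<close> from the equation, but its constraints stay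
  in the constraint set and no other rule can ever remove them; the equation \<open>x = y\<close> with the
  constraint that \<open>y\<close> is the word \<open>a\<close> would then never reach \<open>\<epsilon> = \<epsilon>\<close> with no constraints. As for
  \<open>cancel\<close>, the length guard on the source of the transition makes the removal sound. The rule is
  never applicable to an equation and constraint set all of whose constrained variables occur in
  the equation.\<close>

inductive eq_step :: "('a, 'v) rule \<Rightarrow> ('a, 'v) eqn \<Rightarrow> ('a, 'v) eqn \<Rightarrow> bool" where
  erase_left:
    "L = Var x # w \<Longrightarrow> eq_step (Erase x) (L, R) (subst x [] L, subst x [] R)"
| erase_right:
    "R = Var x # w \<Longrightarrow> eq_step (Erase x) (L, R) (subst x [] L, subst x [] R)"
| cancel:
    "eq_step (Cancel s) (s # w1, s # w2) (w1, w2)"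
| const_left:
    "eq_step (Peel y (Con a)) (Con a # w1, Var y # w2)
       (subst y [Con a, Var y] w1, Var y # subst y [Con a, Var y] w2)"
| const_right:
    "eq_step (Peel x (Con b)) (Var x # w1, Con b # w2)
       (Var x # subst x [Con b, Var x] w1, subst x [Con b, Var x] w2)"
| var_left:
    "x \<noteq> y \<Longrightarrow> eq_step (Peel y (Var x)) (Var x # w1, Var y # w2)
       (subst y [Var x, Var y] w1, Var y # subst y [Var x, Var y] w2)"
| var_right:
    "x \<noteq> y \<Longrightarrow> eq_step (Peel x (Var y)) (Var x # w1, Var y # w2)
       (Var x # subst x [Var y, Var x] w1, subst x [Var y, Var x] w2)"
| discard:
    "x \<notin> vars E \<Longrightarrow> eq_step (Discard x) E E"

text \<open>In the cases for \<open>Peel\<close>, \<open>g c\<close> is the state guessed for the constraint \<open>c\<close> on \<open>y\<close>.\<close>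

fun con_step ::
  "('a, 'v) rule \<Rightarrow> ('a, 'v, 's) rcon set \<Rightarrow> ('a, 'v, 's) rcon set \<Rightarrow> bool" where
  "con_step (Erase x) S S' \<longleftrightarrow>
     (\<forall>c\<in>S. con_var c = x \<longrightarrow> [] \<in> con_lang c) \<and> S' = remove_cons x S"
| "con_step (Cancel (Con a)) S S' \<longleftrightarrow> S' = S"
| "con_step (Cancel (Var x)) S S' \<longleftrightarrow> S' = remove_cons x S"
| "con_step (Peel y (Con a)) S S' \<longleftrightarrow>
     (\<exists>g. (\<forall>c\<in>S. con_var c = y \<longrightarrow> g c \<in> nfa_states (con_nfa c) \<and>
             [a] \<in> nfa_lang (nfa_between (con_nfa c) (con_src c) (g c))) \<and>
          S' = remove_cons y S
            \<union> {In y (con_nfa c) (g c) (con_dst c) | c. c \<in> S \<and> con_var c = y})"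
| "con_step (Peel y (Var x)) S S' \<longleftrightarrow>
     (\<exists>g. (\<forall>c\<in>S. con_var c = y \<longrightarrow> g c \<in> nfa_states (con_nfa c)) \<and>
          S' = remove_cons y S
            \<union> {In y (con_nfa c) (g c) (con_dst c) | c. c \<in> S \<and> con_var c = y}
            \<union> {In x (con_nfa c) (con_src c) (g c) | c. c \<in> S \<and> con_var c = y})"
| "con_step (Discard x) S S' \<longleftrightarrow> (\<exists>c\<in>S. con_var c = x) \<and> S' = remove_cons x S"

type_synonym ('a, 'v, 's) state = "('a, 'v) eqn \<times> ('a, 'v, 's) rcon set"

definition nielsen_step ::
  "('a, 'v) rule \<Rightarrow> ('a, 'v, 's) state \<Rightarrow> ('a, 'v, 's) state \<Rightarrow> bool" where
  "nielsen_step \<rho> s s' \<longleftrightarrow> eq_step \<rho> (fst s) (fst s') \<and> con_step \<rho> (snd s) (snd s')"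

definition nielsen_reach :: "('a, 'v, 's) state \<Rightarrow> ('a, 'v, 's) state \<Rightarrow> bool" where
  "nielsen_reach = (\<lambda>s s'. \<exists>\<rho>. nielsen_step \<rho> s s')\<^sup>*\<^sup>*"


section \<open>Counter systems\<close>

text \<open>A transition formula is represented by the relation it defines between the old and the new
  counter values; vectors indexed by the counters \<open>X\<close> are elements of \<open>X \<rightarrow>\<^sub>E UNIV\<close>.\<close>

type_synonym 'v update = "('v \<Rightarrow> nat) \<Rightarrow> ('v \<Rightarrow> nat) \<Rightarrow> bool"

record ('v, 'q) counter_system =
  counters :: "'v set"
  controls :: "'q set"
  transitions :: "('q \<times> 'v update \<times> 'q) set"

definition configs :: "('v, 'q) counter_system \<Rightarrow> ('q \<times> ('v \<Rightarrow> nat)) set" where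
  "configs C = controls C \<times> (counters C \<rightarrow>\<^sub>E UNIV)"

definition config_step ::
  "('v, 'q) counter_system \<Rightarrow> 'q \<times> ('v \<Rightarrow> nat) \<Rightarrow> 'q \<times> ('v \<Rightarrow> nat) \<Rightarrow> bool" where
  "config_step C c c' \<longleftrightarrow> c \<in> configs C \<and> c' \<in> configs C \<and>
     (\<exists>\<Phi>. (fst c, \<Phi>, fst c') \<in> transitions C \<and> \<Phi> (snd c) (snd c'))"

definition reaches ::
  "('v, 'q) counter_system \<Rightarrow> 'q \<times> ('v \<Rightarrow> nat) \<Rightarrow> 'q \<times> ('v \<Rightarrow> nat) \<Rightarrow> bool" where
  "reaches C = (config_step C)\<^sup>*\<^sup>*"

definition ID :: "'v set \<Rightarrow> 'v update" where
  "ID X v v' \<longleftrightarrow> (\<forall>x\<in>X. v' x = v x)"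

definition SUB :: "'v set \<Rightarrow> 'v \<Rightarrow> 'v \<Rightarrow> 'v update" where
  "SUB X y z v v' \<longleftrightarrow> v z \<le> v y \<and> v' y = v y - v z \<and> (\<forall>x\<in>X. x \<noteq> y \<longrightarrow> v' x = v x)"

definition DEC :: "'v set \<Rightarrow> 'v \<Rightarrow> 'v update" where
  "DEC X y v v' \<longleftrightarrow> v y > 0 \<and> v' y = v y - 1 \<and> (\<forall>x\<in>X. x \<noteq> y \<longrightarrow> v' x = v x)"

fun rule_formula :: "'v set \<Rightarrow> ('a, 'v) rule \<Rightarrow> 'v update" where
  "rule_formula X (Erase y) v v' \<longleftrightarrow> v y = 0 \<and> ID X v v'"
| "rule_formula X (Cancel s) v v' \<longleftrightarrow> ID X v v'"
| "rule_formula X (Peel y (Con a)) v v' \<longleftrightarrow> DEC X y v v'"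
| "rule_formula X (Peel y (Var z)) v v' \<longleftrightarrow> SUB X y z v v'"
| "rule_formula X (Discard y) v v' \<longleftrightarrow> ID X v v'"

definition step_formula ::
  "'v set \<Rightarrow> ('a, 'v) rule \<Rightarrow> ('a, 'v, 's) rcon set \<Rightarrow> ('a, 'v, 's) rcon set \<Rightarrow> 'v update" where
  "step_formula X \<rho> S1 S2 v v' \<longleftrightarrow> rule_formula X \<rho> v v' \<and>
     (\<forall>x\<in>X. v x \<in> Len (lang_of S1 x) \<and> v' x \<in> Len (lang_of S2 x))"

definition nielsen_cs ::
  "'v set \<Rightarrow> ('a, 'v) eqn \<Rightarrow> ('a, 'v, 's) rcon set \<Rightarrow> ('v, ('a, 'v, 's) state) counter_system" where
  "nielsen_cs V E S =
     \<lparr>counters = V,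
      controls = {s. nielsen_reach (E, S) s},
      transitions = {(s1, step_formula V \<rho> (snd s1) (snd s2), s2) | s1 \<rho> s2.
        nielsen_reach (E, S) s1 \<and> nielsen_step \<rho> s1 s2}\<rparr>"

end

theory Submission imports Defs begin

text \<open>
  A step of the Nielsen transformation can be followed on solutions: the counter formula of the step
  relates the lengths of a solution of the source to those of a solution of the target. Backwards,
  a solution of the target extends to one of the source; when a rule drops a variable together with
  its constraints, quadraticity ensures that the variable no longer occurs in the target, so that
  the length guard provides a word of the right length for it. Forwards, a solution selects a rule,
  and the triple consisting of the length of the common image of both sides, the number of symbols
  in the equation and the number of constraints decreases lexicographically.
\<close>

section \<open>Assignments\<close>

text \<open>A homomorphism fixing the constants is determined by its values on variables. Working
  with those values alone turns the splitting or erasing of a variable into a function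
  update.\<close>

definition ext :: "('v \<Rightarrow> 'a list) \<Rightarrow> ('a, 'v) word \<Rightarrow> 'a list" where
  "ext f w = concat (map (case_sym (\<lambda>a. [a]) f) w)"

lemma ext_simps [simp]:
  "ext f [] = []"
  "ext f (Con a # w) = a # ext f w"
  "ext f (Var x # w) = f x @ ext f w"
  "ext f (u @ w) = ext f u @ ext f w"
  by (simp_all add: ext_def)

lemma ext_Cons: "ext f (s # w) = ext f [s] @ ext f w"
  by (cases s) simp_all

lemma const_hom_ext: "const_hom (ext f)"
  by (simp add: const_hom_def)

lemma const_hom_eq_ext:
  assumes "const_hom \<sigma>"
  shows "\<sigma> w = ext (\<lambda>x. \<sigma> [Var x]) w"
proof (induction w)
  case Nil
  then show ?case using assms by (simp add: const_hom_def)
next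
  case (Cons s w)
  have "\<sigma> (s # w) = \<sigma> [s] @ \<sigma> w"
    using assms unfolding const_hom_def by (metis append_Cons append_Nil)
  then show ?case using assms Cons by (cases s) (simp_all add: const_hom_def)
qed

lemma ext_cong: "(\<And>x. Var x \<in> set w \<Longrightarrow> f x = g x) \<Longrightarrow> ext f w = ext g w"
  by (induction w) (auto simp: ext_def split: sym.split)

lemma subst_simps [simp]:
  "subst z u [] = []"
  "subst z u (s # w) = (if s = Var z then u else [s]) @ subst z u w"
  by (simp_all add: subst_def)

text \<open>Substituting in the word and then evaluating amounts to changing the assignment at one
  variable. The semantic correctness of erasing and splitting rests on this trade.\<close>

lemma ext_subst: "ext f (subst z u w) = ext (f(z := ext f u)) w"
proof (induction w)
  case (Cons s w)
  then show ?case by (cases s) simp_all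
qed simp

lemma count_list_subst:
  "count_list (subst z u w) s =
     (if s = Var z then 0 else count_list w s) + count_list w (Var z) * count_list u s"
  by (induction w) auto

lemma length_subst_Nil: "length (subst x [] w) \<le> length w"
  by (induction w) auto

lemma set_subst: "set (subst z u w) \<subseteq> set w \<union> set u"
  by (induction w) auto

section \<open>Solutions, constraint satisfaction and length vectors of assignments\<close>

definition solves :: "('v \<Rightarrow> 'a list) \<Rightarrow> ('a, 'v) eqn \<Rightarrow> bool" where
  "solves f E \<longleftrightarrow> ext f (fst E) = ext f (snd E)"

definition sat :: "('v \<Rightarrow> 'a list) \<Rightarrow> ('a, 'v, 's) rcon set \<Rightarrow> bool" where
  "sat f S \<longleftrightarrow> (\<forall>c\<in>S. f (con_var c) \<in> con_lang c)"

text \<open>The restriction to \<open>V\<close> makes length vectors extensional, so that agreement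
  on \<open>V\<close> is equality.\<close>

definition lens :: "'v set \<Rightarrow> ('v \<Rightarrow> 'a list) \<Rightarrow> 'v \<Rightarrow> nat" where
  "lens V f = (\<lambda>x\<in>V. length (f x))"

lemma lens_apply [simp]: "x \<in> V \<Longrightarrow> lens V f x = length (f x)"
  by (simp add: lens_def)

lemma lens_in_PiE: "lens V f \<in> V \<rightarrow>\<^sub>E UNIV"
  by (simp add: lens_def)

lemma eq_lensI:
  assumes "v \<in> V \<rightarrow>\<^sub>E UNIV" "\<And>x. x \<in> V \<Longrightarrow> v x = length (f x)"
  shows "v = lens V f"
  by (rule PiE_ext[OF assms(1) lens_in_PiE]) (simp add: assms(2))

lemma solution_iff_assignment:
  "(\<exists>\<sigma>. solution \<sigma> E \<and> satisfies \<sigma> S \<and> v = (\<lambda>x\<in>V. length (\<sigma> [Var x]))) \<longleftrightarrow>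
   (\<exists>f. solves f E \<and> sat f S \<and> v = lens V f)" (is "?l \<longleftrightarrow> ?r")
proof
  assume ?l
  then obtain \<sigma> where \<sigma>: "const_hom \<sigma>" "\<sigma> (fst E) = \<sigma> (snd E)" "satisfies \<sigma> S"
    "v = (\<lambda>x\<in>V. length (\<sigma> [Var x]))" by (auto simp: solution_def)
  have "solves (\<lambda>x. \<sigma> [Var x]) E"
    using \<sigma>(2) by (simp add: solves_def const_hom_eq_ext[OF \<sigma>(1), symmetric])
  with \<sigma> show ?r by (auto simp: satisfies_def sat_def lens_def)
next
  assume ?r
  then obtain f where f: "solves f E" "sat f S" "v = lens V f" by blast
  then have "solution (ext f) E \<and> satisfies (ext f) S \<and> v = (\<lambda>x\<in>V. length (ext f [Var x]))"
    by (simp add: solution_def const_hom_ext solves_def satisfies_def sat_def lens_def)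
  then show ?l by blast
qed

section \<open>Constraints\<close>

lemma nfa_run_nfa_between: "nfa_run (nfa_between M p q) r w t \<longleftrightarrow> nfa_run M r w t"
  by (induction w arbitrary: r) (simp_all add: nfa_between_def)

lemma nfa_lang_nfa_between [simp]: "nfa_lang (nfa_between M p q) = {w. nfa_run M p w q}"
  using nfa_run_nfa_between[of M p q] by (simp add: nfa_lang_def) (simp add: nfa_between_def)

lemma con_lang_eq: "con_lang c = {w. nfa_run (con_nfa c) (con_src c) w (con_dst c)}"
  by (simp add: con_lang_def)

lemma nfa_run_append: "nfa_run M p (u @ w) q \<longleftrightarrow> (\<exists>r. nfa_run M p u r \<and> nfa_run M r w q)"
  by (induction u arbitrary: p) auto

lemma nfa_run_state:
  assumes "wf_nfa M" "nfa_run M p w q" "p \<in> nfa_states M"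
  shows "q \<in> nfa_states M"
  using assms(2,3)
proof (induction w arbitrary: p)
  case (Cons a w)
  then obtain r where "(p, a, r) \<in> nfa_trans M" "nfa_run M r w q" by auto
  moreover from this assms(1) have "r \<in> nfa_states M" by (auto simp: wf_nfa_def)
  ultimately show ?case using Cons.IH by blast
qed simp

lemma in_lang_of_iff: "w \<in> lang_of S x \<longleftrightarrow> (\<forall>c\<in>S. con_var c = x \<longrightarrow> w \<in> con_lang c)"
  by (auto simp: lang_of_def)

lemma sat_length_in_Len: "sat f S \<Longrightarrow> length (f x) \<in> Len (lang_of S x)"
  by (auto simp: sat_def Len_def in_lang_of_iff)

lemma sat_remove_cons: "sat f S \<Longrightarrow> sat f (remove_cons x S)"
  by (simp add: sat_def remove_cons_def)

lemma sat_upd: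
  "sat f (remove_cons x S) \<Longrightarrow> w \<in> lang_of S x \<Longrightarrow> sat (f(x := w)) S"
  by (auto simp: sat_def remove_cons_def in_lang_of_iff)

text \<open>A run on the peeled prefix ending in the guessed state and a run on the rest starting
  there compose to a run on the whole value of \<open>y\<close>. For a constant the first run is the
  side condition of the step, for a variable it is a constraint in \<open>S'\<close>.\<close>

lemma sat_peel_source:
  assumes "con_step (Peel y s) S S'" "sat f S'" "s \<noteq> Var y"
  shows "sat (f(y := ext f [s] @ f y)) S"
proof -
  have other: "f (con_var c) \<in> con_lang c" if "c \<in> S" "con_var c \<noteq> y" for c
  proof -
    have "c \<in> S'" using that assms(1) by (cases s) (auto simp: remove_cons_def)
    then show ?thesis using assms(2) by (simp add: sat_def)
  qed
  have split: "ext f [s] @ f y \<in> con_lang c" if "c \<in> S" "con_var c = y" for c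
  proof (cases s)
    case (Con a)
    with assms(1) obtain g where
      "\<forall>c\<in>S. con_var c = y \<longrightarrow> nfa_run (con_nfa c) (con_src c) [a] (g c)"
      "{In y (con_nfa c) (g c) (con_dst c) | c. c \<in> S \<and> con_var c = y} \<subseteq> S'"
      by auto
    with that have "nfa_run (con_nfa c) (con_src c) [a] (g c)"
      "In y (con_nfa c) (g c) (con_dst c) \<in> S'" by blast+
    moreover from this(2) have "nfa_run (con_nfa c) (g c) (f y) (con_dst c)"
      using assms(2) by (force simp: sat_def con_lang_eq)
    ultimately show ?thesis using Con by (auto simp: con_lang_eq)
  next
    case (Var x)
    with assms(1) obtain g where
      "{In y (con_nfa c) (g c) (con_dst c) | c. c \<in> S \<and> con_var c = y} \<subseteq> S'"
      "{In x (con_nfa c) (con_src c) (g c) | c. c \<in> S \<and> con_var c = y} \<subseteq> S'"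
      by auto
    with that have "In y (con_nfa c) (g c) (con_dst c) \<in> S'"
      "In x (con_nfa c) (con_src c) (g c) \<in> S'" by blast+
    then have "nfa_run (con_nfa c) (g c) (f y) (con_dst c)"
      "nfa_run (con_nfa c) (con_src c) (f x) (g c)"
      using assms(2) by (force simp: sat_def con_lang_eq)+
    then show ?thesis using Var by (auto simp: con_lang_eq nfa_run_append)
  qed
  show ?thesis using other split by (simp add: sat_def)
qed

lemma sat_peel_target:
  assumes "sat f S" "\<And>c. c \<in> S \<Longrightarrow> wf_con c" "f y = ext f [s] @ u" "s \<noteq> Var y"
  shows "\<exists>S'. con_step (Peel y s) S S' \<and> sat (f(y := u)) S'"
proof -
  have "\<exists>r. nfa_run (con_nfa c) (con_src c) (ext f [s]) r \<and> nfa_run (con_nfa c) r u (con_dst c)"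
    if "c \<in> S" "con_var c = y" for c
    using that assms(1,3) by (auto simp: sat_def con_lang_eq nfa_run_append)
  \<comment> \<open>The guess for each constraint is the state in which an accepting run on
    \<open>f y\<close> stands after reading the image of \<open>s\<close>.\<close>
  then obtain g where g: "\<And>c. c \<in> S \<Longrightarrow> con_var c = y \<Longrightarrow>
      nfa_run (con_nfa c) (con_src c) (ext f [s]) (g c) \<and> nfa_run (con_nfa c) (g c) u (con_dst c)"
    by metis
  have st: "g c \<in> nfa_states (con_nfa c)" if "c \<in> S" "con_var c = y" for c
    using g[OF that] assms(2)[OF that(1)] nfa_run_state unfolding wf_con_def by metis
  let ?K = "remove_cons y S \<union> {In y (con_nfa c) (g c) (con_dst c) | c. c \<in> S \<and> con_var c = y}"
  have K: "sat (f(y := u)) ?K"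
    using assms(1) g by (auto simp: sat_def remove_cons_def con_lang_eq)
  show ?thesis
  proof (cases s)
    case (Con a)
    have "con_step (Peel y s) S ?K"
      unfolding Con con_step.simps by (rule exI[of _ g]) (use st g Con in auto)
    with K show ?thesis by blast
  next
    case (Var x)
    let ?K' = "?K \<union> {In x (con_nfa c) (con_src c) (g c) | c. c \<in> S \<and> con_var c = y}"
    have "con_step (Peel y s) S ?K'"
      unfolding Var con_step.simps by (rule exI[of _ g]) (use st in auto)
    \<comment> \<open>Since \<open>x\<close> differs from \<open>y\<close>, the update leaves
      \<open>f x\<close> intact, and \<open>f x\<close> is the prefix read up to the guessed
      state.\<close>
    moreover have "sat (f(y := u)) ?K'"
      using K g Var assms(4) unfolding sat_def ball_Un by (auto simp: con_lang_eq)
    ultimately show ?thesis by blast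
  qed
qed

text \<open>The guards \<open>v y > 0\<close> and \<open>v z \<le> v y\<close> keep the
  natural-number subtraction from truncating, so the old counter value is recovered by adding back
  the length of the image of \<open>s\<close>.\<close>

lemma rule_formula_peel_source:
  assumes "v \<in> V \<rightarrow>\<^sub>E UNIV" "rule_formula V (Peel y s) v (lens V f)" "y \<in> V"
    "\<And>x. s = Var x \<Longrightarrow> x \<in> V" "s \<noteq> Var y"
  shows "v = lens V (f(y := ext f [s] @ f y))"
proof (rule eq_lensI[OF assms(1)])
  fix x assume "x \<in> V"
  then show "v x = length ((f(y := ext f [s] @ f y)) x)"
    using assms by (cases s) (auto simp: DEC_def SUB_def)
qed

lemma rule_formula_peel_target:
  assumes "f y = ext f [s] @ u" "y \<in> V" "\<And>x. s = Var x \<Longrightarrow> x \<in> V" "s \<noteq> Var y"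
  shows "rule_formula V (Peel y s) (lens V f) (lens V (f(y := u)))"
  using assms by (cases s) (auto simp: DEC_def SUB_def)

section \<open>Nielsen steps\<close>

lemma eq_step_swap: "eq_step \<rho> (L, R) (L', R') \<Longrightarrow> eq_step \<rho> (R, L) (R', L')"
  by (erule eq_step.cases) (auto intro: eq_step.intros simp: vars_def simp del: subst_simps)

lemma eq_step_peelI:
  assumes "s \<noteq> Var y"
  shows "eq_step (Peel y s) (s # w1, Var y # w2)
    (subst y [s, Var y] w1, Var y # subst y [s, Var y] w2)"
  using assms by (cases s) (auto intro: eq_step.intros)

text \<open>The four splitting rules collapse to two mirror images, whether \<open>s\<close> is a
  constant or a variable.\<close>

lemma eq_step_peelE:
  assumes "eq_step (Peel y s) (L, R) E'"
  obtains w1 w2 where "s \<noteq> Var y" "L = s # w1" "R = Var y # w2"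
      "E' = (subst y [s, Var y] w1, Var y # subst y [s, Var y] w2)"
    | w1 w2 where "s \<noteq> Var y" "R = s # w1" "L = Var y # w2"
      "E' = (Var y # subst y [s, Var y] w2, subst y [s, Var y] w1)"
  using assms by (cases rule: eq_step.cases) auto

text \<open>As \<open>s\<close> is not \<open>y\<close>, its image survives the update at
  \<open>y\<close>. Under the updated assignment both sides of the old equation start with this
  image, and cancelling it leaves the new equation.\<close>

lemma solves_peel:
  assumes "s \<noteq> Var y"
  shows "ext f (subst y [s, Var y] w1) = ext f (Var y # subst y [s, Var y] w2) \<longleftrightarrow>
    ext (f(y := ext f [s] @ f y)) (s # w1) = ext (f(y := ext f [s] @ f y)) (Var y # w2)"
proof -
  have "ext (f(y := ext f [s] @ f y)) [s] = ext f [s]"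
    by (rule ext_cong) (use assms in auto)
  moreover have "ext f [s, Var y] = ext f [s] @ f y" by (cases s) simp_all
  ultimately show ?thesis
    by (subst ext_Cons[of _ s]) (simp add: ext_subst)
qed

text \<open>Constrained variables are required to lie in \<open>V\<close> and not in the equation,
  because splitting can remove a variable from the equation while its constraints remain.\<close>

definition state_inv :: "'v set \<Rightarrow> ('a, 'v, 's) state \<Rightarrow> bool" where
  "state_inv V p \<longleftrightarrow> vars (fst p) \<subseteq> V \<and> quadratic (fst p) \<and> finite (snd p) \<and>
     (\<forall>c\<in>snd p. wf_con c \<and> con_var c \<in> V)"

section \<open>Preservation of the invariant\<close>

lemma vars_eq_step:
  assumes "eq_step \<rho> E E'"
  shows "vars E' \<subseteq> vars E"
  using assms
  by cases (auto simp: vars_def dest!: subsetD[OF set_subst])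

text \<open>Besides the leading \<open>y\<close> at most one further \<open>y\<close> occurs, so the
  substitution adds at most one copy of \<open>s\<close>, which the removal of the leading
  \<open>s\<close> makes up for. The number of occurrences of \<open>y\<close> is unchanged.\<close>

lemma quadratic_peel:
  assumes "s \<noteq> Var y" "quadratic (s # w1, Var y # w2)"
  shows "quadratic (subst y [s, Var y] w1, Var y # subst y [s, Var y] w2)"
  unfolding quadratic_def
proof
  fix x
  have q: "count_list (s # w1 @ Var y # w2) (Var z) \<le> 2" for z
    using assms(2) by (simp add: quadratic_def)
  show "count_list (fst (subst y [s, Var y] w1, Var y # subst y [s, Var y] w2) @
      snd (subst y [s, Var y] w1, Var y # subst y [s, Var y] w2)) (Var x) \<le> 2"
    using q[of x] q[of y] assms(1) by (auto simp: count_list_subst split: if_splits)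
qed

lemma quadratic_swap: "quadratic (L, R) \<longleftrightarrow> quadratic (R, L)"
  by (simp add: quadratic_def add.commute)

lemma quadratic_eq_step:
  assumes "eq_step \<rho> E E'" "quadratic E"
  shows "quadratic E'"
proof (cases \<rho>)
  case (Peel y s)
  obtain L R where E: "E = (L, R)" by fastforce
  from assms(1)[unfolded Peel E] show ?thesis
    by (cases rule: eq_step_peelE) (use assms(2) E quadratic_peel quadratic_swap in metis)+
next
  case (Erase x)
  then have "E' = (subst x [] (fst E), subst x [] (snd E))"
    using assms(1) by (auto elim: eq_step.cases)
  then show ?thesis using assms(2) by (auto simp: quadratic_def count_list_subst)
next
  case (Cancel s)
  then obtain w1 w2 where "E = (s # w1, s # w2)" "E' = (w1, w2)"
    using assms(1) by (auto elim: eq_step.cases)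
  moreover have "count_list (w1 @ w2) t \<le> count_list (s # w1 @ s # w2) t" for t
    by simp
  ultimately show ?thesis using assms(2) unfolding quadratic_def
    by (auto intro: order_trans)
next
  case (Discard x)
  then show ?thesis using assms by (auto elim: eq_step.cases)
qed

lemma con_step_preserves:
  assumes "con_step \<rho> S S'" "finite S" "\<forall>c\<in>S. wf_con c \<and> con_var c \<in> V"
    "\<And>y s. \<rho> = Peel y s \<Longrightarrow> y \<in> V" "\<And>y x. \<rho> = Peel y (Var x) \<Longrightarrow> x \<in> V"
  shows "finite S' \<and> (\<forall>c\<in>S'. wf_con c \<and> con_var c \<in> V)"
  using assms
  by (cases "(\<rho>, S, S')" rule: con_step.cases) (auto simp: remove_cons_def wf_con_def)

lemma vars_peel:
  assumes "eq_step (Peel y s) E E'"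
  shows "y \<in> vars E" "s = Var x \<Longrightarrow> x \<in> vars E"
  using assms by (auto elim!: eq_step.cases simp: vars_def)

lemma state_inv_step:
  assumes "nielsen_step \<rho> p p'" "state_inv V p"
  shows "state_inv V p'"
proof -
  have e: "eq_step \<rho> (fst p) (fst p')" and c: "con_step \<rho> (snd p) (snd p')"
    using assms(1) by (auto simp: nielsen_step_def)
  have "finite (snd p') \<and> (\<forall>c\<in>snd p'. wf_con c \<and> con_var c \<in> V)"
    by (rule con_step_preserves[OF c]) (use assms(2) e vars_peel[of _ _ "fst p" "fst p'"] in \<open>auto simp: state_inv_def\<close>)
  then show ?thesis
    using assms(2) vars_eq_step[OF e] quadratic_eq_step[OF e] by (auto simp: state_inv_def)
qed

section \<open>Counter runs\<close>

text \<open>The transition relation of \<^const>\<open>nielsen_cs\<close> freed from the requirement that control states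
  be reachable from a fixed initial state.\<close>

definition run_step ::
  "'v set \<Rightarrow> ('a, 'v, 's) state \<times> ('v \<Rightarrow> nat) \<Rightarrow> ('a, 'v, 's) state \<times> ('v \<Rightarrow> nat) \<Rightarrow> bool" where
  "run_step V c c' \<longleftrightarrow> snd c \<in> V \<rightarrow>\<^sub>E UNIV \<and> snd c' \<in> V \<rightarrow>\<^sub>E UNIV \<and>
     (\<exists>\<rho>. nielsen_step \<rho> (fst c) (fst c') \<and>
       step_formula V \<rho> (snd (fst c)) (snd (fst c')) (snd c) (snd c'))"

lemma config_step_nielsen_cs:
  "config_step (nielsen_cs V E S) c c' \<longleftrightarrow> nielsen_reach (E, S) (fst c) \<and> run_step V c c'"
proof -
  have "nielsen_reach (E, S) (fst c')"
    if "nielsen_reach (E, S) (fst c)" "nielsen_step \<rho> (fst c) (fst c')" for \<rho>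
    using that unfolding nielsen_reach_def by (auto intro: rtranclp.rtrancl_into_rtrancl)
  moreover have "(\<exists>\<Phi>. (fst c, \<Phi>, fst c') \<in> transitions (nielsen_cs V E S) \<and> \<Phi> (snd c) (snd c')) \<longleftrightarrow>
    nielsen_reach (E, S) (fst c) \<and> (\<exists>\<rho>. nielsen_step \<rho> (fst c) (fst c') \<and>
      step_formula V \<rho> (snd (fst c)) (snd (fst c')) (snd c) (snd c'))"
    unfolding nielsen_cs_def counter_system.simps by blast
  moreover have "d \<in> configs (nielsen_cs V E S) \<longleftrightarrow>
    nielsen_reach (E, S) (fst d) \<and> snd d \<in> V \<rightarrow>\<^sub>E UNIV" for d
    by (cases d) (simp add: configs_def nielsen_cs_def)
  ultimately show ?thesis
    unfolding config_step_def run_step_def by blast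
qed

lemma reaches_nielsen_cs:
  "reaches (nielsen_cs V E S) ((E, S), v) c \<longleftrightarrow> (run_step V)\<^sup>*\<^sup>* ((E, S), v) c"
proof
  assume "reaches (nielsen_cs V E S) ((E, S), v) c"
  then show "(run_step V)\<^sup>*\<^sup>* ((E, S), v) c"
    unfolding reaches_def
    by (rule rtranclp_mono[THEN predicate2D, rotated]) (auto simp: config_step_nielsen_cs)
next
  assume "(run_step V)\<^sup>*\<^sup>* ((E, S), v) c"
  \<comment> \<open>Reachability of the current control state is carried through the induction,
    since every configuration step demands it of its source.\<close>
  then have "nielsen_reach (E, S) (fst c) \<and> reaches (nielsen_cs V E S) ((E, S), v) c"
  proof induction
    case base
    then show ?case by (simp add: nielsen_reach_def reaches_def)
  next
    case (step c d)
    then have "config_step (nielsen_cs V E S) c d" by (simp add: config_step_nielsen_cs)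
    moreover from this have "nielsen_reach (E, S) (fst d)"
      by (auto simp: config_step_def configs_def nielsen_cs_def)
    ultimately show ?case
      using step.IH unfolding reaches_def by (auto intro: rtranclp.rtrancl_into_rtrancl)
  qed
  then show "reaches (nielsen_cs V E S) ((E, S), v) c" by blast
qed

text \<open>The length guards come for free: the values of satisfying assignments are themselves
  words of the required lengths in the constraint languages.\<close>

lemma run_stepI:
  assumes "eq_step \<rho> E E'" "con_step \<rho> S S'" "sat f S" "sat f' S'"
    "rule_formula V \<rho> (lens V f) (lens V f')"
  shows "run_step V ((E, S), lens V f) ((E', S'), lens V f')"
proof -
  have "step_formula V \<rho> S S' (lens V f) (lens V f')"
    using assms(3-5) by (simp add: step_formula_def sat_length_in_Len)
  then show ?thesis
    using assms(1,2) by (auto simp: run_step_def nielsen_step_def lens_in_PiE)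
qed

section \<open>From runs to solutions\<close>

lemma solves_upd_absent: "x \<notin> vars E \<Longrightarrow> solves (f(x := w)) E \<longleftrightarrow> solves f E"
  unfolding solves_def vars_def
  by (intro arg_cong2[where f = "(=)"] ext_cong) auto

text \<open>The guard at \<open>x\<close> yields a word of length \<open>v x\<close> meeting all
  constraints on \<open>x\<close> at once. As \<open>x\<close> does not occur in the equation, this
  word can replace \<open>f x\<close> without harm.\<close>

lemma drop_variable_source:
  assumes "x \<notin> vars E" "solves f E" "sat f (remove_cons x S)" "x \<in> V"
    "v \<in> V \<rightarrow>\<^sub>E UNIV" "ID V v (lens V f)" "v x \<in> Len (lang_of S x)"
  shows "\<exists>w. solves (f(x := w)) E \<and> sat (f(x := w)) S \<and> v = lens V (f(x := w))"
proof -
  obtain w where w: "w \<in> lang_of S x" "length w = v x"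
    using assms(7) by (auto simp: Len_def)
  have "v = lens V (f(x := w))"
    by (rule eq_lensI[OF assms(5)]) (use assms(6) w in \<open>auto simp: ID_def\<close>)
  then show ?thesis
    using sat_upd[OF assms(3) w(1)] solves_upd_absent[OF assms(1)] assms(2) by blast
qed

lemma run_step_source:
  assumes "run_step V ((E, S), v) ((E', S'), lens V f)" "state_inv V (E, S)"
    "solves f E'" "sat f S'"
  shows "\<exists>f'. solves f' E \<and> sat f' S \<and> v = lens V f'"
proof -
  from assms(1) obtain \<rho> where v: "v \<in> V \<rightarrow>\<^sub>E UNIV" and e: "eq_step \<rho> E E'"
    and c: "con_step \<rho> S S'" and r: "rule_formula V \<rho> v (lens V f)"
    and len: "\<And>x. x \<in> V \<Longrightarrow> v x \<in> Len (lang_of S x)"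
    by (auto simp: run_step_def nielsen_step_def step_formula_def)
  have V: "vars E \<subseteq> V" using assms(2) by (simp add: state_inv_def)
  have same: "v = lens V f" if "ID V v (lens V f)"
    by (rule eq_lensI[OF v]) (use that in \<open>auto simp: ID_def\<close>)
  show ?thesis
  proof (cases \<rho>)
    case (Erase x)
    have E': "E' = (subst x [] (fst E), subst x [] (snd E))" and x: "x \<in> vars E"
      using e Erase by (auto elim!: eq_step.cases simp: vars_def)
    have "v = lens V f" using same r Erase by simp
    moreover have "v x = 0" using r Erase by simp
    \<comment> \<open>The counter of \<open>x\<close> is zero before and after the step, so
      \<open>f x\<close> is already the empty word.\<close>
    ultimately have "f(x := []) = f" using x V by (auto intro!: fun_upd_idem)
    moreover have "solves (f(x := [])) E" using assms(3) E' by (simp add: solves_def ext_subst)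
    moreover have "sat (f(x := [])) S"
      by (rule sat_upd) (use assms(4) c Erase in \<open>auto simp: in_lang_of_iff\<close>)
    ultimately show ?thesis using \<open>v = lens V f\<close> by metis
  next
    case (Cancel s)
    then obtain w1 w2 where E: "E = (s # w1, s # w2)" "E' = (w1, w2)"
      using e by (auto elim: eq_step.cases)
    have lift: "solves f' E" if "solves f' E'" for f'
      using that unfolding E solves_def by (simp add: ext_Cons[of _ s w1] ext_Cons[of _ s w2])
    show ?thesis
    proof (cases s)
      case (Con a)
      then show ?thesis using same r c Cancel lift assms(3,4) by auto
    next
      case (Var x)
      \<comment> \<open>The two cancelled occurrences exhaust the quota of \<open>x\<close>, so
        \<open>x\<close> is absent from \<open>E'\<close> and its value may be chosen anew.\<close>
      have "count_list (s # w1 @ s # w2) (Var x) \<le> 2"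
        using assms(2) E by (simp add: state_inv_def quadratic_def)
      then have "x \<notin> vars E'" using E Var by (auto simp: vars_def count_list_0_iff)
      moreover have "x \<in> V" using V E Var by (auto simp: vars_def)
      ultimately show ?thesis
        using drop_variable_source[of x E' f S V v] assms(3,4) c r v len Cancel Var lift by auto
    qed
  next
    case (Peel y s)
    have y: "y \<in> V" and s: "\<And>x. s = Var x \<Longrightarrow> x \<in> V"
      using vars_peel[of y s E E'] e V Peel by auto
    obtain L R where E: "E = (L, R)" by fastforce
    from e[unfolded Peel E] have "s \<noteq> Var y \<and> solves (f(y := ext f [s] @ f y)) E"
      by (cases rule: eq_step_peelE)
        (use assms(3) E solves_peel[of s y f] in \<open>auto simp: solves_def eq_commute\<close>)
    then show ?thesis
      using sat_peel_source[of y s S S' f] rule_formula_peel_source[OF v _ y s, of s f]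
        assms(4) c r Peel by blast
  next
    case (Discard x)
    then have "E' = E" "x \<notin> vars E" using e by (auto elim: eq_step.cases)
    moreover have "x \<in> V" using c Discard assms(2) by (auto simp: state_inv_def)
    ultimately show ?thesis
      using drop_variable_source[of x E f S V v] assms(3,4) c r v len Discard by auto
  qed
qed

lemma solution_of_run:
  assumes "(run_step V)\<^sup>*\<^sup>* c (((([], []), {}) :: ('a, 'v, 's) state), w)"
    "w \<in> V \<rightarrow>\<^sub>E UNIV" "state_inv V (fst c)"
  shows "\<exists>f. solves f (fst (fst c)) \<and> sat f (snd (fst c)) \<and> snd c = lens V f"
  using assms(1,3)
proof (induction rule: converse_rtranclp_induct)
  case base
  \<comment> \<open>The final equation and constraint set accept every assignment, so only the
    lengths matter and the letter is arbitrary.\<close>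
  have "w = lens V (\<lambda>x. replicate (w x) undefined)"
    by (rule eq_lensI[OF assms(2)]) simp
  then show ?case by (auto simp: solves_def sat_def)
next
  case (step c d)
  have "state_inv V (fst d)"
    using step.hyps(1) step.prems state_inv_step unfolding run_step_def by blast
  with step.IH obtain f where
    "solves f (fst (fst d))" "sat f (snd (fst d))" "snd d = lens V f" by blast
  then show ?case
    using run_step_source[of V "fst (fst c)" "snd (fst c)" "snd c" "fst (fst d)" "snd (fst d)" f]
      step.hyps(1) step.prems by (metis prod.collapse)
qed

section \<open>From solutions to runs\<close>

text \<open>Two non-empty prefixes of one word are comparable. Distinct constants cannot both begin
  it, so one leading symbol is a variable whose value starts with the image of the other.\<close>

lemma prefix_cases:
  assumes "ext f (s # w1) = ext f (t # w2)" "s \<noteq> t" "ext f [s] \<noteq> []" "ext f [t] \<noteq> []"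
  obtains y u where "t = Var y" "f y = ext f [s] @ u"
    | y u where "s = Var y" "f y = ext f [t] @ u"
proof -
  have eq: "ext f [s] @ ext f w1 = ext f [t] @ ext f w2"
    using assms(1) ext_Cons[of f s w1] ext_Cons[of f t w2] by simp
  show ?thesis
  proof (cases s)
    case (Con a)
    show ?thesis
    proof (cases t)
      case t: (Var z)
      have "f z = a # tl (f z)" using eq Con t assms(4) by (cases "f z") auto
      then show ?thesis using that(1)[of z "tl (f z)"] Con t by simp
    qed (use eq Con assms(2) in simp)
  next
    case (Var x)
    show ?thesis
    proof (cases t)
      case (Con b)
      have "f x = b # tl (f x)" using eq Con Var assms(3) by (cases "f x") auto
      then show ?thesis using that(2)[of x "tl (f x)"] Con Var by simp
    next
      case t: (Var z)
      show ?thesis using eq Var t that by (auto simp: append_eq_append_conv2 dest: sym)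
    qed
  qed
qed

text \<open>Both orientations of the equation are covered with the same \<open>S'\<close>, so that
  splitting the left variable needs no second argument. The common image shrinks because the
  non-empty image of \<open>s\<close> is stripped from it.\<close>

lemma peel_run_step:
  assumes "state_inv V ((s # w1, Var y # w2), S)" "sat f S" "s \<noteq> Var y" "f y = ext f [s] @ u"
    "ext f (s # w1) = ext f (Var y # w2)" "ext f [s] \<noteq> []"
  defines "L' \<equiv> subst y [s, Var y] w1" and "R' \<equiv> Var y # subst y [s, Var y] w2"
  shows "\<exists>S'. run_step V (((s # w1, Var y # w2), S), lens V f) (((L', R'), S'), lens V (f(y := u)))
      \<and> run_step V (((Var y # w2, s # w1), S), lens V f) (((R', L'), S'), lens V (f(y := u)))
      \<and> state_inv V ((L', R'), S') \<and> state_inv V ((R', L'), S') \<and> sat (f(y := u)) S'"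
    and "ext (f(y := u)) L' = ext (f(y := u)) R'"
    and "length (ext (f(y := u)) L') < length (ext f (s # w1))"
proof -
  have e: "eq_step (Peel y s) (s # w1, Var y # w2) (L', R')"
    unfolding L'_def R'_def by (rule eq_step_peelI[OF assms(3)])
  have inV: "y \<in> V" "\<And>x. s = Var x \<Longrightarrow> x \<in> V"
    using assms(1) by (auto simp: state_inv_def vars_def)
  have wf: "\<And>c. c \<in> S \<Longrightarrow> wf_con c" using assms(1) by (simp add: state_inv_def)
  obtain S' where S': "con_step (Peel y s) S S'" "sat (f(y := u)) S'"
    using sat_peel_target[OF assms(2) wf assms(4,3)] by blast
  have r: "rule_formula V (Peel y s) (lens V f) (lens V (f(y := u)))"
    by (rule rule_formula_peel_target[OF assms(4) inV assms(3)])
  have inv: "state_inv V ((L', R'), S')"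
    by (rule state_inv_step[OF _ assms(1), of "Peel y s"]) (use e S' in \<open>simp add: nielsen_step_def\<close>)
  then have "state_inv V ((R', L'), S')"
    by (auto simp: state_inv_def quadratic_swap[of L' R'] vars_def)
  with inv S' show "\<exists>S'. run_step V (((s # w1, Var y # w2), S), lens V f)
        (((L', R'), S'), lens V (f(y := u)))
      \<and> run_step V (((Var y # w2, s # w1), S), lens V f) (((R', L'), S'), lens V (f(y := u)))
      \<and> state_inv V ((L', R'), S') \<and> state_inv V ((R', L'), S') \<and> sat (f(y := u)) S'"
    using run_stepI[OF e S'(1) assms(2) S'(2) r]
      run_stepI[OF eq_step_swap[OF e] S'(1) assms(2) S'(2) r] by blast
  have s: "ext (f(y := u)) [s] = ext f [s]"
    by (rule ext_cong) (use assms(3) in auto)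
  \<comment> \<open>Putting the image of \<open>s\<close> back in front of \<open>u\<close> recovers
    \<open>f\<close>, which is the assignment that \<open>solves_peel\<close> relates to the old
    equation.\<close>
  then have restore: "(f(y := u))(y := ext (f(y := u)) [s] @ (f(y := u)) y) = f"
    using assms(4) by auto
  show "ext (f(y := u)) L' = ext (f(y := u)) R'"
    unfolding L'_def R'_def solves_peel[OF assms(3)] restore by (rule assms(5))
  have "ext (f(y := u)) [s, Var y] = f y"
    using s assms(4) ext_Cons[of "f(y := u)" s "[Var y]"] by simp
  then have "ext (f(y := u)) L' = ext f w1"
    unfolding L'_def ext_subst by simp
  then show "length (ext (f(y := u)) L') < length (ext f (s # w1))"
    using assms(6) ext_Cons[of f s w1] by simp
qed

text \<open>Cancelling and splitting shorten the common image, though splitting may enlarge the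
  other components. Erasing a variable with empty value keeps the image and shortens the equation,
  and discarding keeps both and lowers the number of constraints.\<close>

lemma run_of_solution:
  fixes f :: "'v \<Rightarrow> 'a list" and S :: "('a, 'v, 's) rcon set"
  assumes "state_inv V ((L, R), S)" "ext f L = ext f R" "sat f S"
  shows "\<exists>w \<in> V \<rightarrow>\<^sub>E UNIV. (run_step V)\<^sup>*\<^sup>* (((L, R), S), lens V f) ((([], []), {}), w)"
proof -
  have wf: "wf (less_than <*lex*> less_than <*lex*> less_than :: ((nat \<times> nat \<times> nat) \<times> _) set)"
    by (intro wf_lex_prod wf_less_than)
  show ?thesis using assms
  proof (induction "(length (ext f L), length L + length R, card S)" arbitrary: L R S f
      rule: wf_induct_rule[OF wf])
    case (1 L R S f)
    have advance: ?case
      if "run_step V (((L, R), S), lens V f) (((L', R'), S'), lens V f')"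
        "ext f' L' = ext f' R'" "sat f' S'"
        "((length (ext f' L'), length L' + length R', card S'),
          (length (ext f L), length L + length R, card S)) \<in> less_than <*lex*> less_than <*lex*> less_than"
      for L' R' S' f'
    proof -
      have "state_inv V ((L', R'), S')"
        using that(1) "1.prems"(1) state_inv_step by (fastforce simp: run_step_def)
      then show ?thesis
        using "1.hyps"[OF that(4) _ that(2,3)] that(1) by (blast intro: converse_rtranclp_into_rtranclp)
    qed
    \<comment> \<open>Leading variables with empty value are erased first. In the last two cases the
      leading symbols thus have non-empty images, which makes the image length drop.\<close>
    consider (empty) "L = []" "R = []"
      | (erase) x where "f x = []" "(\<exists>w. L = Var x # w) \<or> (\<exists>w. R = Var x # w)"
      | (cancel) s w1 w2 where "L = s # w1" "R = s # w2" "ext f [s] \<noteq> []"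
      | (split) s w1 t w2 where "L = s # w1" "R = t # w2" "s \<noteq> t" "ext f [s] \<noteq> []" "ext f [t] \<noteq> []"
    proof -
      have ne: "ext f (s # w) \<noteq> []" "ext f [s] \<noteq> []"
        if "\<nexists>x. f x = [] \<and> s = Var x" for s :: "('a, 'v) sym" and w
        using that by (cases s; auto)+
      show ?thesis
      proof (cases "\<exists>x. f x = [] \<and> ((\<exists>w. L = Var x # w) \<or> (\<exists>w. R = Var x # w))")
        case True
        then show ?thesis using that(2) by blast
      next
        case False
        have iff: "L = [] \<longleftrightarrow> R = []"
        proof -
          have "ext f L \<noteq> []" if "L = s # w" for s w
            unfolding that by (rule ne(1)) (use False that in blast)
          moreover have "ext f R \<noteq> []" if "R = s # w" for s w
            unfolding that by (rule ne(1)) (use False that in blast)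
          ultimately show ?thesis using "1.prems"(2) by (metis ext_simps(1) list.exhaust)
        qed
        show ?thesis
        proof (cases L)
          case Nil
          then show ?thesis using that(1) iff by blast
        next
          case L: (Cons s w1)
          then have s: "ext f [s] \<noteq> []" using False ne(2) by blast
          show ?thesis
          proof (cases R)
            case Nil
            then show ?thesis using L iff by blast
          next
            case R: (Cons t w2)
            then have "ext f [t] \<noteq> []" using False ne(2) by blast
            then show ?thesis using that(3,4) L R s by (cases "s = t") blast+
          qed
        qed
      qed
    qed
    then show ?case
    proof cases
      case empty
      show ?thesis
      proof (cases "S = {}")
        case True
        then show ?thesis
          using empty by (intro bexI[OF _ lens_in_PiE[of V f]]) simp
      next
        case False
        then obtain c where c: "c \<in> S" by blast
        \<comment> \<open>Constraints may survive on variables that have left the equation; they are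
          removed one variable at a time.\<close>
        have e: "eq_step (Discard (con_var c)) (L, R) (L, R)"
          by (rule discard) (simp add: empty vars_def)
        have "run_step V (((L, R), S), lens V f) (((L, R), remove_cons (con_var c) S), lens V f)"
          by (rule run_stepI[OF e _ "1.prems"(3) sat_remove_cons[OF "1.prems"(3)]])
            (use c in \<open>auto simp: ID_def\<close>)
        moreover have "card (remove_cons (con_var c) S) < card S"
          using "1.prems"(1) c by (intro psubset_card_mono) (auto simp: state_inv_def remove_cons_def)
        ultimately show ?thesis
          using advance "1.prems"(2) sat_remove_cons[OF "1.prems"(3)] by simp
      qed
    next
      case erase
      have e: "eq_step (Erase x) (L, R) (subst x [] L, subst x [] R)"
        using erase(2) by (auto intro: eq_step.intros)
      have c: "con_step (Erase x) S (remove_cons x S)"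
        using "1.prems"(3) erase(1) by (force simp: sat_def)
      have "x \<in> V" using erase(2) "1.prems"(1) by (auto simp: state_inv_def vars_def)
      then have "run_step V (((L, R), S), lens V f)
          (((subst x [] L, subst x [] R), remove_cons x S), lens V f)"
        by (intro run_stepI[OF e c "1.prems"(3) sat_remove_cons[OF "1.prems"(3)]])
          (use erase(1) in \<open>simp add: ID_def\<close>)
      \<comment> \<open>Substituting the empty word for a variable that already has this value
        changes no image, so \<open>f\<close> still solves the shorter equation.\<close>
      moreover have "ext f (subst x [] w) = ext f w" for w
        using erase(1) by (simp add: ext_subst fun_upd_idem)
      moreover have "length (subst x [] L) + length (subst x [] R) < length L + length R"
        using erase(2) length_subst_Nil[of x L] length_subst_Nil[of x R]
          length_subst_Nil[of x "tl L"] length_subst_Nil[of x "tl R"] by auto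
      ultimately show ?thesis
        using advance "1.prems"(2) sat_remove_cons[OF "1.prems"(3)] by simp
    next
      case cancel
      have e: "eq_step (Cancel s) (L, R) (w1, w2)"
        unfolding cancel by (rule eq_step.cancel)
      obtain S' where S': "con_step (Cancel s) S S'" "sat f S'"
        using "1.prems"(3) sat_remove_cons by (cases s) fastforce+
      have "run_step V (((L, R), S), lens V f) (((w1, w2), S'), lens V f)"
        by (rule run_stepI[OF e S'(1) "1.prems"(3) S'(2)]) (simp add: ID_def)
      moreover have "ext f w1 = ext f w2" "length (ext f w1) < length (ext f L)"
        using "1.prems"(2) cancel ext_Cons[of f s w1] ext_Cons[of f s w2] by simp_all
      ultimately show ?thesis using advance S'(2) by simp
    next
      case split
      note prems = "1.prems"
      from "1.prems"(2)[unfolded split] split(3-5) show ?thesis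
      proof (cases rule: prefix_cases)
        case (1 y u)
        show ?thesis
          using peel_run_step[of V s w1 y w2 S f u] advance prems split 1 by auto
      next
        case (2 y u)
        \<comment> \<open>Here the split variable leads the left side. \<open>peel_run_step\<close>
          is applied to the swapped equation, and its mirrored run is the one from
          \<open>(L, R)\<close>.\<close>
        have "state_inv V ((R, L), S)"
          using prems(1) by (auto simp: state_inv_def quadratic_swap[of L R] vars_def)
        then show ?thesis
          using peel_run_step[of V t w2 y w1 S f u] advance prems split 2 by auto
      qed
    qed
  qed
qed

theorem theorem3:
  fixes V :: "'v set"
    and E :: "('a::finite, 'v) eqn"
    and S :: "('a, 'v, 's) rcon set"
    and v :: "'v \<Rightarrow> nat"
  assumes "finite V" and "vars E \<subseteq> V" and "quadratic E"
    and "finite S" and "\<And>c. c \<in> S \<Longrightarrow> wf_con c \<and> con_var c \<in> vars E"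
    and "v \<in> V \<rightarrow>\<^sub>E UNIV"
  shows "(\<exists>\<sigma>. solution \<sigma> E \<and> satisfies \<sigma> S \<and> v = (\<lambda>x\<in>V. length (\<sigma> [Var x]))) \<longleftrightarrow>
    (\<exists>w \<in> V \<rightarrow>\<^sub>E UNIV. reaches (nielsen_cs V E S) ((E, S), v) ((([], []), {}), w))"
proof -
  have inv: "state_inv V (E, S)"
    using assms(2-5) by (auto simp: state_inv_def)
  show ?thesis
    unfolding solution_iff_assignment reaches_nielsen_cs
  proof
    assume "\<exists>f. solves f E \<and> sat f S \<and> v = lens V f"
    then show "\<exists>w \<in> V \<rightarrow>\<^sub>E UNIV. (run_step V)\<^sup>*\<^sup>* ((E, S), v) ((([], []), {}), w)"
      using run_of_solution[of V "fst E" "snd E" S] inv by (auto simp: solves_def)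
  next
    assume "\<exists>w \<in> V \<rightarrow>\<^sub>E UNIV. (run_step V)\<^sup>*\<^sup>* ((E, S), v) ((([], []), {}), w)"
    then show "\<exists>f. solves f E \<and> sat f S \<and> v = lens V f"
      using solution_of_run[of V "((E, S), v)"] inv by auto
  qed
qed

end
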